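(* Let $a\ne0,1$, $x$ and $c$ be real numbers and let $n,m\ge1$ be integers. Then $$\mathrm{C.T.}\big|_{\mathbf{z}=0}\ \prod_{j=1}^n\frac{\left(1-\frac{z_j}{a}\right)^{x}}{(1-z_j)^{x+c+n-1}z_j^{m+n-1}}\prod_{1\le i<j\le n}(z_i-z_j)^2=(-1)^{\binom m2+\binom n2+nm}\,n!\,a^{\binom m2}\det\left(m_{n+i-1}^{a,-c-n-i-j+3}(-x+j-1)\right)_{i,j=1}^m.$$
   Context: $\mathrm{C.T.}|_{\mathbf{z}=0}F(\mathbf{z})$ is the constant term of the Laurent expansion of $F$ at $\mathbf{z}=(z_1,\dots,z_n)=(0,\dots,0)$; the powers $(1-z/a)^x$ and $(1-z)^{y}$ are expanded as the binomial series in $z$ with value $1$ at $z=0$. The Meixner polynomials $m_n^{a,c}$ are defined, for $a\neq0,1$, by the generating function $$\left(1-\frac za\right)^x(1-z)^{-x-c}=\sum_{n=0}^\infty m_n^{a,c}(x)z^n.$$ *)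

theory Defs
  imports
    "HOL-Analysis.Analysis"
    "HOL-Computational_Algebra.Formal_Power_Series"
    "Jordan_Normal_Form.Determinant"
begin

(* Laurent expansion at 0 of a function of z_1, ..., z_n.  A point is a function z on the
   indices, of which only the values z 1, ..., z n matter; an exponent vector is an integer
   function on {1..n}, extensional so that each vector occurs once in the summation.  The
   multiple series has to converge unconditionally on the polydisc of radius r with the
   coordinate hyperplanes z_j = 0 removed. *)
definition has_multi_laurent_expansion ::
  "nat \<Rightarrow> ((nat \<Rightarrow> complex) \<Rightarrow> complex) \<Rightarrow> ((nat \<Rightarrow> int) \<Rightarrow> complex) \<Rightarrow> bool" where
  "has_multi_laurent_expansion n F b \<longleftrightarrow>
     (\<exists>r>0. \<forall>z. (\<forall>j\<in>{1..n}. 0 < norm (z j) \<and> norm (z j) < r) \<longrightarrow>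
        ((\<lambda>k. b k * (\<Prod>j=1..n. z j powi k j)) has_sum F z) ({1..n} \<rightarrow>\<^sub>E (UNIV :: int set)))"

(* The coefficients of such an expansion are unique, so the description below is
   determined whenever an expansion exists. *)
definition constant_term :: "nat \<Rightarrow> ((nat \<Rightarrow> complex) \<Rightarrow> complex) \<Rightarrow> complex" where
  "constant_term n F =
     (THE t. \<exists>b. has_multi_laurent_expansion n F b \<and> t = b (\<lambda>j\<in>{1..n}. 0))"

definition meixner_gf :: "real \<Rightarrow> real \<Rightarrow> real \<Rightarrow> real fps" where
  "meixner_gf a c x =
     (fps_binomial x oo (fps_const (- (1 / a)) * fps_X)) * (fps_binomial (- x - c) oo (- fps_X))"

definition meixner :: "real \<Rightarrow> real \<Rightarrow> nat \<Rightarrow> real \<Rightarrow> real" where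
  "meixner a c n x = fps_nth (meixner_gf a c x) n"

(* Near 0 the bases 1 - z_j / a and 1 - z_j lie in the right half-plane, where the principal
   power powr is the sum of the binomial series and takes the value 1 at z_j = 0. *)
definition meixner_integrand ::
  "real \<Rightarrow> real \<Rightarrow> real \<Rightarrow> nat \<Rightarrow> nat \<Rightarrow> (nat \<Rightarrow> complex) \<Rightarrow> complex" where
  "meixner_integrand a c x n m z =
     (\<Prod>j=1..n. (1 - z j / of_real a) powr of_real x /
        ((1 - z j) powr of_real (x + c + real n - 1) * z j ^ (m + n - 1))) *
     (\<Prod>j=1..n. \<Prod>i\<in>{1..<j}. (z i - z j)\<^sup>2)"

(* Jordan_Normal_Form matrices are indexed from 0, hence the shift to i, j = 1, ..., m. *)
definition meixner_matrix :: "real \<Rightarrow> real \<Rightarrow> real \<Rightarrow> nat \<Rightarrow> nat \<Rightarrow> real Matrix.mat" where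
  "meixner_matrix a c x n m =
     Matrix.mat m m (\<lambda>(i0, j0). let i = i0 + 1; j = j0 + 1 in
       meixner a (- c - real n - real i - real j + 3) (n + i - 1) (- x + real j - 1))"

end

(* With f = (1 - z/a)^x (1 - z)^(-x-c-n+1) = sum_k p_k z^k, write the squared Vandermonde product, up
   to the sign (-1)^binom(n,2) and a power of prod_j z_j, as det(z_j^i) det(z_j^(-i)).  Expanding both
   determinants over permutations and taking constant terms gives n! det(p_(m+j-i)), an n x n
   Toeplitz determinant.  By Jacobi's identity for complementary minors of inverse matrices, it equals
   (-1)^(nm) times the m x m Toeplitz determinant det(q_(n+j-i)) of the coefficients of 1/f.  The
   (i, j) entry of the Meixner matrix, with indices from 0, is the coefficient of z^(n+i) in
   (1 - z)^i (1 - z/a)^j / f, so that matrix arises from the transpose of (q_(n+j-i)) by triangular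
   row and column operations, of determinants 1 and (-1/a)^binom(m,2). *)

theory Submission
  imports Defs
begin

subsection \<open>Toeplitz and Vandermonde determinants\<close>

text \<open>Toeplitz indices such as \<open>m + j - i\<close> can be negative and must then give 0,
  whereas truncated subtraction on \<open>nat\<close> would return the coefficient of index
  0.\<close>

definition fps_coeff_int :: "'a::zero fps \<Rightarrow> int \<Rightarrow> 'a" where
  "fps_coeff_int f k = (if k < 0 then 0 else fps_nth f (nat k))"

lemma fps_coeff_int_neg [simp]: "k < 0 \<Longrightarrow> fps_coeff_int f k = 0"
  by (simp add: fps_coeff_int_def)

lemma fps_coeff_int_of_nat [simp]: "fps_coeff_int f (int k) = fps_nth f k"
  by (simp add: fps_coeff_int_def)

text \<open>Gives the Cauchy product a summation range independent of \<open>K\<close>, as matrix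
  products require. The two alternatives in the hypothesis cover a polynomial \<open>f\<close>, and
  indices beyond \<open>K\<close>, where the coefficient of \<open>g\<close> has negative
  index.\<close>

lemma fps_coeff_int_mult:
  fixes f g :: "'a::semiring_0 fps"
  assumes "\<And>k. k \<ge> N \<Longrightarrow> fps_nth f k = 0 \<or> int k > K"
  shows "fps_coeff_int (f * g) K = (\<Sum>k<N. fps_nth f k * fps_coeff_int g (K - int k))"
proof (cases "K < 0")
  case False
  then obtain M where K: "K = int M"
    by (metis not_less zero_le_imp_eq_int)
  have "fps_coeff_int (f * g) K = (\<Sum>k\<in>{0..M}. fps_nth f k * fps_nth g (M - k))"
    by (simp add: K fps_mult_nth)
  also have "\<dots> = (\<Sum>k\<in>{0..M}. fps_nth f k * fps_coeff_int g (K - int k))"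
    by (intro sum.cong refl) (simp add: K fps_coeff_int_def nat_diff_distrib)
  also have "\<dots> = (\<Sum>k\<in>{0..M} \<union> {..<N}. fps_nth f k * fps_coeff_int g (K - int k))"
    by (intro sum.mono_neutral_left) (auto simp: K)
  also have "\<dots> = (\<Sum>k<N. fps_nth f k * fps_coeff_int g (K - int k))"
  proof (intro sum.mono_neutral_right ballI)
    fix k assume "k \<in> {0..M} \<union> {..<N} - {..<N}"
    with assms[of k] show "fps_nth f k * fps_coeff_int g (K - int k) = 0"
      by (cases "int k > K") auto
  qed auto
  finally show ?thesis .
qed simp

text \<open>A row operation: reversing the Cauchy sum turns multiplication by a polynomial of degree
  at most \<open>i\<close> into the action of row \<open>i\<close> of a lower triangular matrix. The
  polynomial may vary with the row.\<close>

lemma fps_coeff_int_mult_lower: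
  fixes f g :: "'a::semiring_0 fps"
  assumes "i < N" and "\<And>k. k > i \<Longrightarrow> fps_nth f k = 0"
  shows "fps_coeff_int (f * g) (K + int i) =
    (\<Sum>k<N. fps_coeff_int f (int i - int k) * fps_coeff_int g (K + int k))"
proof -
  have "fps_coeff_int (f * g) (K + int i) =
      (\<Sum>k<Suc i. fps_nth f k * fps_coeff_int g (K + int i - int k))"
    by (intro fps_coeff_int_mult) (use assms(2) in auto)
  also have "\<dots> = (\<Sum>k<Suc i. fps_coeff_int f (int i - int k) * fps_coeff_int g (K + int k))"
    by (rule sum.reindex_bij_witness[of _ "\<lambda>k. i - k" "\<lambda>k. i - k"])
       (auto simp: algebra_simps)
  also have "\<dots> = (\<Sum>k<N. fps_coeff_int f (int i - int k) * fps_coeff_int g (K + int k))"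
    using assms(1) by (intro sum.mono_neutral_left) auto
  finally show ?thesis .
qed

text \<open>Upper triangular Toeplitz matrices multiply like their power series, since only the
  \<open>k\<close> between \<open>i\<close> and \<open>j\<close> contribute.\<close>

lemma fps_coeff_int_mult_upper:
  fixes f g :: "'a::semiring_0 fps"
  assumes "j < N"
  shows "(\<Sum>k<N. fps_coeff_int f (int k - int i) * fps_coeff_int g (int j - int k)) =
    fps_coeff_int (f * g) (int j - int i)"
proof -
  have "fps_coeff_int (f * g) (int j - int i) =
      (\<Sum>k<N. fps_nth f k * fps_coeff_int g (int j - int i - int k))"
    using assms by (intro fps_coeff_int_mult) auto
  also have "\<dots> = (\<Sum>k\<in>{i..<i+N}. fps_nth f (k - i) * fps_coeff_int g (int j - int k))"
    by (rule sum.reindex_bij_witness[of _ "\<lambda>k. k - i" "\<lambda>k. k + i"]) (auto simp: algebra_simps)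
  also have "\<dots> = (\<Sum>k\<in>{i..<i+N}. fps_coeff_int f (int k - int i) * fps_coeff_int g (int j - int k))"
    by (intro sum.cong refl) (auto simp: fps_coeff_int_def nat_diff_distrib)
  also have "\<dots> = (\<Sum>k\<in>{i..<i+N} \<union> {..<N}. fps_coeff_int f (int k - int i) * fps_coeff_int g (int j - int k))"
    by (intro sum.mono_neutral_left) auto
  also have "\<dots> = (\<Sum>k<N. fps_coeff_int f (int k - int i) * fps_coeff_int g (int j - int k))"
    using assms by (intro sum.mono_neutral_right) auto
  finally show ?thesis by simp
qed

section \<open>Determinants of matrices given by entry functions, and Jacobi's identity for Toeplitz
  matrices\<close>

lemma det_lower_triangular_mat:
  fixes A :: "nat \<Rightarrow> nat \<Rightarrow> 'a::comm_ring_1"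
  assumes "\<And>i j. i < j \<Longrightarrow> j < n \<Longrightarrow> A i j = 0"
  shows "Determinant.det (Matrix.mat n n (\<lambda>(i,j). A i j)) = (\<Prod>i<n. A i i)"
proof -
  have "Determinant.det (Matrix.mat n n (\<lambda>(i,j). A i j)) =
      prod_list (diag_mat (Matrix.mat n n (\<lambda>(i,j). A i j)))"
    by (rule det_lower_triangular[of n]) (use assms in auto)
  also have "\<dots> = (\<Prod>i<n. A i i)"
    by (simp add: prod_list_diag_prod lessThan_atLeast0)
  finally show ?thesis .
qed

lemma det_upper_triangular_mat:
  fixes A :: "nat \<Rightarrow> nat \<Rightarrow> 'a::comm_ring_1"
  assumes "\<And>i j. j < i \<Longrightarrow> i < n \<Longrightarrow> A i j = 0"
  shows "Determinant.det (Matrix.mat n n (\<lambda>(i,j). A i j)) = (\<Prod>i<n. A i i)"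
proof -
  have "Determinant.det (Matrix.mat n n (\<lambda>(i,j). A i j)) =
      prod_list (diag_mat (Matrix.mat n n (\<lambda>(i,j). A i j)))"
    by (rule det_upper_triangular[of _ n]) (use assms in \<open>auto simp: upper_triangular_def\<close>)
  also have "\<dots> = (\<Prod>i<n. A i i)"
    by (simp add: prod_list_diag_prod lessThan_atLeast0)
  finally show ?thesis .
qed

lemma mat_mult_mat:
  "Matrix.mat n k (\<lambda>(i,j). A i j) * Matrix.mat k m (\<lambda>(i,j). B i j) =
   Matrix.mat n m (\<lambda>(i,j). \<Sum>l<k. A i l * (B l j :: 'a::semiring_0))"
  by (intro eq_matI) (auto simp: scalar_prod_def lessThan_atLeast0 intro!: sum.cong)

lemma det_transpose_mat:
  "Determinant.det (Matrix.mat n n (\<lambda>(i,j). A j i)) =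
   Determinant.det (Matrix.mat n n (\<lambda>(i,j). (A i j :: 'a::comm_ring_1)))"
proof -
  have "Matrix.mat n n (\<lambda>(i,j). A j i) = transpose_mat (Matrix.mat n n (\<lambda>(i,j). A i j))"
    by (intro eq_matI) auto
  then show ?thesis
    by (metis det_transpose mat_carrier)
qed

lemma det_toeplitz_inverse:
  fixes f g :: "'a::idom fps"
  assumes fg: "f * g = 1" and f0: "fps_nth f 0 = 1"
  shows "Determinant.det (Matrix.mat m m (\<lambda>(i,j). fps_coeff_int g (int n + int j - int i))) =
    (-1) ^ (n * m) * Determinant.det (Matrix.mat n n (\<lambda>(i,j). fps_coeff_int f (int m + int j - int i)))"
    (is "Determinant.det ?F = _ * Determinant.det ?B")
proof -
  define N where "N = m + n"
  define P where "P = Matrix.mat N N (\<lambda>(i,j). fps_coeff_int f (int j - int i))"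
  define r where "r = (\<lambda>k l. if l < m then fps_coeff_int g (int n + int l - int k)
    else if k = l then 1 else (0::'a))"
  \<comment> \<open>The first \<open>m\<close> columns of \<open>R\<close> are the last \<open>m\<close> columns of the inverse of \<open>P\<close>.\<close>
  define R where "R = Matrix.mat N N (\<lambda>(k,l). r k l)"
  \<comment> \<open>The entries of \<open>P * R\<close>: the first \<open>m\<close> columns are unit
    vectors with the 1 in row \<open>n + l\<close>, because \<open>f * g = 1\<close>; the others are
    columns of \<open>P\<close>, because there \<open>R\<close> agrees with the identity.\<close>
  define s where "s = (\<lambda>i l. if l < m then if i = n + l then 1 else 0
    else fps_coeff_int f (int l - int i))"
  have R_blocks: "R = four_block_mat ?F (0\<^sub>m m n)
      (Matrix.mat n m (\<lambda>(k,l). r (k + m) l)) (1\<^sub>m n)"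
    by (intro eq_matI) (auto simp: R_def N_def r_def)
  have "Determinant.det P = (\<Prod>i<N. fps_coeff_int f (int i - int i))"
    unfolding P_def by (rule det_upper_triangular_mat) auto
  also have "\<dots> = 1"
    by (simp add: fps_coeff_int_def f0)
  finally have det_P: "Determinant.det P = 1" .
  have PR: "P * R = Matrix.mat N N (\<lambda>(i,l). s i l)"
  proof -
    have "(\<Sum>k<N. fps_coeff_int f (int k - int i) * r k l) = s i l" if "i < N" "l < N" for i l
    proof (cases "l < m")
      case True
      have "(\<Sum>k<N. fps_coeff_int f (int k - int i) * r k l) =
          (\<Sum>k<N. fps_coeff_int f (int k - int i) * fps_coeff_int g (int (n + l) - int k))"
        using True by (simp add: r_def)
      also have "\<dots> = fps_coeff_int (f * g) (int (n + l) - int i)"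
        by (rule fps_coeff_int_mult_upper) (use True in \<open>simp add: N_def\<close>)
      also have "\<dots> = s i l"
        using True by (auto simp: fg fps_coeff_int_def s_def)
      finally show ?thesis .
    next
      case False
      then have "(\<Sum>k<N. fps_coeff_int f (int k - int i) * r k l) =
          (\<Sum>k<N. if k = l then fps_coeff_int f (int k - int i) else 0)"
        by (intro sum.cong) (auto simp: r_def)
      with False that show ?thesis
        by (simp add: s_def)
    qed
    then show ?thesis
      unfolding P_def R_def mat_mult_mat by (intro eq_matI) auto
  qed
  have "Determinant.det ?F = Determinant.det R"
    unfolding R_blocks by (subst det_four_block_mat_upper_right_zero[of _ m _ n]) auto
  also have "\<dots> = Determinant.det (P * R)"
    by (subst det_mult[of _ N]) (auto simp: det_P, auto simp: P_def R_def)
  \<comment> \<open>Moving the last \<open>m\<close> rows above the first \<open>n\<close> takes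
    \<open>n * m\<close> transpositions and turns the unit columns into an identity block, which
    leaves \<open>?B\<close> as the complementary block.\<close>
  also have "\<dots> = (-1) ^ (n * m) * Determinant.det (Matrix.mat N N (\<lambda>(i, j).
      (P * R) $$ (if i < m then i + n else if i < n + m then i - m else i, j)))"
    by (rule det_swap_initial_rows) (auto simp: PR N_def)
  also have "Matrix.mat N N (\<lambda>(i, j).
        (P * R) $$ (if i < m then i + n else if i < n + m then i - m else i, j)) =
      four_block_mat (1\<^sub>m m) (Matrix.mat m n (\<lambda>(i,j). s (i + n) (j + m))) (0\<^sub>m n m) ?B"
    unfolding PR by (intro eq_matI) (auto simp: N_def s_def algebra_simps)
  also have "Determinant.det \<dots> = Determinant.det ?B"
    by (subst det_four_block_mat_lower_left_zero[of _ m _ n]) auto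
  finally show ?thesis .
qed

section \<open>Vandermonde determinants and sums over pairs of permutations\<close>

lemma det_vandermonde:
  fixes z :: "nat \<Rightarrow> 'a::idom"
  shows "Determinant.det (Matrix.mat n n (\<lambda>(i,j). z i ^ j)) = (\<Prod>j<n. \<Prod>i<j. z j - z i)"
proof -
  \<comment> \<open>In the Newton basis \<open>p\<close> the Vandermonde matrix becomes triangular; as the \<open>p j\<close> are monic of
    degree \<open>j\<close>, the change of basis has determinant 1.\<close>
  define p where "p = (\<lambda>j. \<Prod>i<j. [:- z i, 1:])"
  have deg: "degree (p j) = j" for j
    unfolding p_def by (subst degree_prod_eq_sum_degree) auto
  have lead: "coeff (p j) j = 1" for j
  proof -
    have "lead_coeff (p j) = 1"
      unfolding p_def lead_coeff_prod by simp
    then show ?thesis by (simp add: deg)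
  qed
  define V where "V = Matrix.mat n n (\<lambda>(i,j). z i ^ j)"
  define U where "U = Matrix.mat n n (\<lambda>(k,j). coeff (p j) k)"
  have "Determinant.det U = (\<Prod>j<n. coeff (p j) j)"
    unfolding U_def by (rule det_upper_triangular_mat) (simp add: coeff_eq_0 deg)
  then have det_U: "Determinant.det U = 1"
    by (simp add: lead)
  have "V * U = Matrix.mat n n (\<lambda>(i,j). \<Sum>k<n. z i ^ k * coeff (p j) k)"
    unfolding V_def U_def by (rule mat_mult_mat)
  also have "\<dots> = Matrix.mat n n (\<lambda>(i,j). \<Prod>l<j. z i - z l)"
  proof (intro eq_matI; clarsimp)
    fix i j assume "j < n"
    have "(\<Sum>k<n. z i ^ k * coeff (p j) k) = (\<Sum>k\<le>j. z i ^ k * coeff (p j) k)"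
      by (rule sum.mono_neutral_right) (use \<open>j < n\<close> in \<open>auto simp: coeff_eq_0 deg\<close>)
    also have "\<dots> = poly (p j) (z i)"
      by (simp add: poly_altdef deg mult.commute)
    also have "\<dots> = (\<Prod>l<j. z i - z l)"
      by (simp add: p_def poly_prod algebra_simps)
    finally show "(\<Sum>k<n. z i ^ k * coeff (p j) k) = (\<Prod>l<j. z i - z l)" .
  qed
  finally have "Determinant.det (V * U) = Determinant.det (Matrix.mat n n (\<lambda>(i,j). \<Prod>l<j. z i - z l))"
    by simp
  also have "\<dots> = (\<Prod>j<n. \<Prod>i<j. z j - z i)"
    by (rule det_lower_triangular_mat) auto
  finally show ?thesis
    by (subst (asm) det_mult[of _ n]) (auto simp: det_U, auto simp: V_def U_def)
qed

text \<open>For fixed \<open>\<sigma>\<close>, the sum over \<open>\<tau>\<close> is the Leibniz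
  formula for the matrix with rows permuted by \<open>\<sigma>\<close>. Its sign cancels
  \<open>signof \<sigma>\<close>, so all \<open>n!\<close> choices of \<open>\<sigma>\<close>
  contribute the same determinant.\<close>

lemma sum_permutation_pairs_det:
  fixes h :: "nat \<Rightarrow> nat \<Rightarrow> 'a::{comm_ring_1, semiring_char_0}"
  shows "(\<Sum>\<sigma> | \<sigma> permutes {0..<n}. \<Sum>\<tau> | \<tau> permutes {0..<n}.
      signof \<sigma> * signof \<tau> * (\<Prod>j<n. h (\<sigma> j) (\<tau> j))) =
    fact n * Determinant.det (Matrix.mat n n (\<lambda>(i,j). h i j))"
proof -
  let ?H = "Matrix.mat n n (\<lambda>(i,j). h i j)"
  have "(\<Sum>\<tau> | \<tau> permutes {0..<n}. signof \<sigma> * signof \<tau> * (\<Prod>j<n. h (\<sigma> j) (\<tau> j))) =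
      Determinant.det ?H" if \<sigma>: "\<sigma> permutes {0..<n}" for \<sigma>
  proof -
    have *: "\<tau> j < n" if "\<tau> permutes {0..<n}" "j < n" for \<tau> j
      using permutes_in_image[OF that(1), of j] that(2) by simp
    have "(\<Sum>\<tau> | \<tau> permutes {0..<n}. signof \<sigma> * signof \<tau> * (\<Prod>j<n. h (\<sigma> j) (\<tau> j))) =
        signof \<sigma> * Determinant.det (Matrix.mat n n (\<lambda>(i,j). ?H $$ (\<sigma> i, j)))"
      by (subst det_def'[of _ n])
         (use * \<sigma> in \<open>auto simp: sum_distrib_left mult.assoc lessThan_atLeast0 intro!: sum.cong\<close>)
    also have "\<dots> = signof \<sigma> * (signof \<sigma> * Determinant.det ?H)"
      by (subst det_permute_rows[OF _ \<sigma>]) auto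
    also have "\<dots> = Determinant.det ?H"
      by (simp add: sign_def)
    finally show ?thesis .
  qed
  then show ?thesis
    by (simp add: card_permutations[of _ n])
qed

subsection \<open>The determinant of Meixner polynomials\<close>

text \<open>The formal series of (1 + s z)^\<alpha>. With s = -1/a or s = -1 it covers every factor
  of the Meixner generating function and of the integrand.\<close>

definition fps_binomial_scaled :: "'a::field_char_0 \<Rightarrow> 'a \<Rightarrow> 'a fps" where
  "fps_binomial_scaled s \<alpha> = fps_binomial \<alpha> oo (fps_const s * fps_X)"

lemma fps_binomial_scaled_nth: "fps_nth (fps_binomial_scaled s \<alpha>) k = s ^ k * (\<alpha> gchoose k)"
  by (simp add: fps_binomial_scaled_def fps_compose_linear)

lemma fps_binomial_scaled_add:
  "fps_binomial_scaled s (\<alpha> + \<beta>) = fps_binomial_scaled s \<alpha> * fps_binomial_scaled s \<beta>"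
  by (simp add: fps_binomial_scaled_def fps_binomial_add_mult fps_compose_mult_distrib)

lemma fps_binomial_scaled_0: "fps_binomial_scaled s 0 = 1"
  by (simp add: fps_binomial_scaled_def)

lemma fps_binomial_scaled_of_nat_nth:
  "fps_nth (fps_binomial_scaled s (of_nat j)) k = s ^ k * of_nat (j choose k)"
  by (simp add: fps_binomial_scaled_nth binomial_gbinomial)

lemma meixner_gf_eq:
  "meixner_gf a c x = fps_binomial_scaled (- (1 / a)) x * fps_binomial_scaled (- 1) (- x - c)"
proof -
  have "fps_const (- 1) * fps_X = (- fps_X :: real fps)"
    by (simp flip: fps_const_neg)
  then show ?thesis
    by (simp only: meixner_gf_def fps_binomial_scaled_def)
qed

lemma prod_power_lessThan: "(\<Prod>j<m. s ^ j) = (s :: 'a::comm_semiring_1) ^ (m choose 2)"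
  by (induction m) (simp_all add: power_add numeral_2_eq_2 mult.commute add.commute)

text \<open>The matrix factors as \<open>L * T * U\<close> with Toeplitz middle factor
  \<open>T\<close>. The diagonal of \<open>U\<close> consists of the powers of -1/a, and the factor
  in front of the determinant reduces their product to a sign.\<close>

lemma det_meixner_matrix:
  assumes "a \<noteq> 0"
  shows "a ^ (m choose 2) * Determinant.det (meixner_matrix a c x n m) = (- 1) ^ (m choose 2) *
    Determinant.det (Matrix.mat m m (\<lambda>(i,j). fps_coeff_int
      (fps_binomial_scaled (- (1 / a)) (- x) * fps_binomial_scaled (- 1) (x + c + real n - 1))
      (int n + int j - int i)))"
proof -
  define s where "s = - (1 / a)"
  define q where "q = fps_binomial_scaled s (- x) * fps_binomial_scaled (- 1) (x + c + real n - 1)"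
  define L where "L = Matrix.mat m m (\<lambda>(i,k).
    fps_coeff_int (fps_binomial_scaled (- 1 :: real) (real i)) (int i - int k))"
  define T where "T = Matrix.mat m m (\<lambda>(k,l). fps_coeff_int q (int n + int k - int l))"
  define U where "U = Matrix.mat m m (\<lambda>(l,j). fps_nth (fps_binomial_scaled s (real j)) l)"
  have entry: "meixner a (- c - real n - real (i + 1) - real (j + 1) + 3) (n + (i + 1) - 1)
        (- x + real (j + 1) - 1) =
      (\<Sum>l<m. (\<Sum>k<m. fps_coeff_int (fps_binomial_scaled (- 1) (real i)) (int i - int k) *
        fps_coeff_int q (int n + int k - int l)) * fps_nth (fps_binomial_scaled s (real j)) l)"
    if ij: "i < m" "j < m" for i j
  proof -
    \<comment> \<open>The Meixner parameters are such that \<open>j\<close> cancels in the exponent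
      of 1 - z: row and column shift one binomial factor each.\<close>
    have "meixner_gf a (- c - real n - real (i + 1) - real (j + 1) + 3) (- x + real (j + 1) - 1) =
        fps_binomial_scaled s (- x + real j) *
        fps_binomial_scaled (- 1) ((x + c + real n - 1) + real i)"
      by (simp add: meixner_gf_eq s_def algebra_simps)
    also have "\<dots> = fps_binomial_scaled (- 1) (real i) * (fps_binomial_scaled s (real j) * q)"
      unfolding fps_binomial_scaled_add q_def by (simp only: mult_ac)
    finally have "meixner a (- c - real n - real (i + 1) - real (j + 1) + 3) (n + (i + 1) - 1)
        (- x + real (j + 1) - 1) = fps_coeff_int (fps_binomial_scaled (- 1) (real i) *
          (fps_binomial_scaled s (real j) * q)) (int n + int i)"
      unfolding meixner_def by (simp flip: of_nat_add)
    \<comment> \<open>(1 - z)^i, and below (1 - z/a)^j, are polynomials of degree less than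
      \<open>m\<close>, so sums of length \<open>m\<close> capture the whole products.\<close>
    also have "\<dots> = (\<Sum>k<m. fps_coeff_int (fps_binomial_scaled (- 1) (real i)) (int i - int k) *
        fps_coeff_int (fps_binomial_scaled s (real j) * q) (int n + int k))"
      by (rule fps_coeff_int_mult_lower)
         (use ij in \<open>auto simp: fps_binomial_scaled_of_nat_nth binomial_eq_0\<close>)
    also have "\<dots> = (\<Sum>k<m. \<Sum>l<m. fps_coeff_int (fps_binomial_scaled (- 1) (real i)) (int i - int k) *
        fps_coeff_int q (int n + int k - int l) * fps_nth (fps_binomial_scaled s (real j)) l)"
    proof (intro sum.cong refl)
      fix k
      have "fps_coeff_int (fps_binomial_scaled s (real j) * q) (int n + int k) =
          (\<Sum>l<m. fps_nth (fps_binomial_scaled s (real j)) l * fps_coeff_int q (int n + int k - int l))"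
        by (rule fps_coeff_int_mult)
           (use ij in \<open>auto simp: fps_binomial_scaled_of_nat_nth binomial_eq_0\<close>)
      then show "fps_coeff_int (fps_binomial_scaled (- 1) (real i)) (int i - int k) *
          fps_coeff_int (fps_binomial_scaled s (real j) * q) (int n + int k) =
          (\<Sum>l<m. fps_coeff_int (fps_binomial_scaled (- 1) (real i)) (int i - int k) *
            fps_coeff_int q (int n + int k - int l) * fps_nth (fps_binomial_scaled s (real j)) l)"
        by (simp add: sum_distrib_left mult_ac)
    qed
    finally show ?thesis
      by (subst (asm) sum.swap) (simp add: sum_distrib_right)
  qed
  have "meixner_matrix a c x n m = L * T * U"
    unfolding L_def T_def U_def mat_mult_mat meixner_matrix_def Let_def
    by (intro cong_mat refl) (simp only: split_conv entry)
  moreover have "Determinant.det L =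
      (\<Prod>i<m. fps_coeff_int (fps_binomial_scaled (- 1 :: real) (real i)) (int i - int i))"
    unfolding L_def by (rule det_lower_triangular_mat) auto
  then have "Determinant.det L = 1"
    by (simp add: fps_coeff_int_def fps_binomial_scaled_nth)
  moreover have "Determinant.det U = (\<Prod>j<m. fps_nth (fps_binomial_scaled s (real j)) j)"
    unfolding U_def
    by (rule det_upper_triangular_mat) (auto simp: fps_binomial_scaled_of_nat_nth binomial_eq_0)
  then have "Determinant.det U = s ^ (m choose 2)"
    by (simp add: fps_binomial_scaled_of_nat_nth prod_power_lessThan)
  moreover have "Determinant.det (L * T * U) =
      Determinant.det L * Determinant.det T * Determinant.det U"
  proof -
    have "L \<in> carrier_mat m m" "T \<in> carrier_mat m m" "U \<in> carrier_mat m m"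
      by (simp_all add: L_def T_def U_def)
    then show ?thesis
      by (simp add: det_mult[of _ m])
  qed
  ultimately have "Determinant.det (meixner_matrix a c x n m) =
      Determinant.det T * s ^ (m choose 2)"
    by simp
  moreover have "a ^ (m choose 2) * s ^ (m choose 2) = (- 1) ^ (m choose 2)"
    unfolding s_def using assms by (simp flip: power_mult_distrib)
  moreover have "Determinant.det T = Determinant.det (Matrix.mat m m
      (\<lambda>(i,j). fps_coeff_int q (int n + int j - int i)))"
    unfolding T_def by (rule det_transpose_mat)
  ultimately show ?thesis
    by (simp add: q_def s_def mult_ac)
qed

subsection \<open>Coefficients of multiple Laurent series\<close>

text \<open>Unconditional summability of complex series is absolute summability, and this permits
  multiplying out a finite product of series.\<close>

lemma has_sum_prod_PiE:
  fixes f :: "'a \<Rightarrow> 'b \<Rightarrow> complex"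
  assumes "finite A" and "\<And>x. x \<in> A \<Longrightarrow> countable (B x)"
    and sum: "\<And>x. x \<in> A \<Longrightarrow> (f x has_sum s x) (B x)"
  shows "((\<lambda>g. \<Prod>x\<in>A. f x (g x)) has_sum (\<Prod>x\<in>A. s x)) (PiE A B)"
proof -
  have summable: "Infinite_Sum.abs_summable_on (f x) (B x)" if "x \<in> A" for x
    using sum[OF that] summable_on_iff_abs_summable_on_complex summable_on_def by blast
  have "Infinite_Sum.abs_summable_on (\<lambda>g. \<Prod>x\<in>A. f x (g x)) (PiE A B)"
    unfolding abs_summable_equivalent
    by (intro abs_summable_on_prod_PiE assms(1,2) summable[unfolded abs_summable_equivalent])
  then have "(\<lambda>g. \<Prod>x\<in>A. f x (g x)) summable_on PiE A B"
    by (rule abs_summable_summable)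
  moreover have "infsum (\<lambda>g. \<Prod>x\<in>A. f x (g x)) (PiE A B) = (\<Prod>x\<in>A. infsum (f x) (B x))"
    using assms(1) summable by (rule infsum_prod_PiE_abs)
  moreover have "\<dots> = (\<Prod>x\<in>A. s x)"
    using sum by (intro prod.cong refl infsumI)
  ultimately show ?thesis
    by (simp add: has_sum_iff)
qed

section \<open>Uniqueness of the constant coefficient\<close>

lemma sum_roots_of_unity_powi:
  assumes "N > 0"
  shows "(\<Sum>t<N. (cis (2 * pi / real N) ^ t) powi k) =
    (if int N dvd k then of_nat N else 0)"
proof -
  let ?w = "cis (2 * pi / real N)"
  \<comment> \<open>Exchanging the exponents makes the sum geometric with ratio
    \<open>?w powi k\<close>, an \<open>N\<close>-th root of unity that equals 1 exactly when
    \<open>N\<close> divides \<open>k\<close>.\<close>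
  have swap: "(?w ^ t) powi k = (?w powi k) ^ t" for t
    by (simp add: power_int_mult[symmetric] mult.commute flip: power_int_of_nat)
  have wk: "?w powi k = cis (2 * pi * (real_of_int k / real N))"
    by (simp add: cis_power_int mult_ac)
  have wN: "(?w powi k) ^ N = 1"
  proof -
    have "real N * (2 * pi * (real_of_int k / real N)) = 2 * pi * real_of_int k"
      using assms by simp
    then have "(?w powi k) ^ N = cis (2 * pi * real_of_int k)"
      by (simp only: wk Complex.DeMoivre)
    then show ?thesis by (simp add: cis_multiple_2pi)
  qed
  have eq1: "?w powi k = 1 \<longleftrightarrow> int N dvd k"
  proof
    assume "?w powi k = 1"
    then have "cos (2 * pi * (real_of_int k / real N)) = 1"
      by (simp add: wk complex_eq_iff)
    then obtain l :: int where "2 * pi * (real_of_int k / real N) = real_of_int l * 2 * pi"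
      by (auto simp: cos_one_2pi_int)
    then have "real_of_int k = real_of_int (l * int N)"
      using assms by (simp add: field_simps)
    then have "k = l * int N"
      by linarith
    then show "int N dvd k" by simp
  next
    assume "int N dvd k"
    then obtain l where "k = int N * l" by auto
    then have "real_of_int k / real N = real_of_int l"
      using assms by simp
    then have "?w powi k = cis (2 * pi * real_of_int l)"
      by (simp only: wk)
    then show "?w powi k = 1" by (simp add: cis_multiple_2pi)
  qed
  show ?thesis
  proof (cases "int N dvd k")
    case True
    then show ?thesis by (simp add: swap eq1[THEN iffD2])
  next
    case False
    then show ?thesis
      using wN eq1 by (simp add: swap sum_gp_strict)
  qed
qed

lemma has_sum_sum:
  fixes f :: "'a \<Rightarrow> 'b \<Rightarrow> 'c::topological_comm_monoid_add"
  assumes "\<And>i. i \<in> I \<Longrightarrow> (f i has_sum s i) A"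
  shows "((\<lambda>x. \<Sum>i\<in>I. f i x) has_sum (\<Sum>i\<in>I. s i)) A"
  using assms by (induction I rule: infinite_finite_induct) (auto intro: has_sum_add)

text \<open>Averaging over all tuples of \<open>N\<close>-th roots of unity kills every term whose exponents are not all
  divisible by \<open>N\<close>; for large \<open>N\<close> only the constant term and a small tail survive.\<close>

lemma multi_laurent_zero_imp_constant_coeff_zero:
  fixes d :: "(nat \<Rightarrow> int) \<Rightarrow> complex"
  assumes "r > 0" and zero: "\<And>z. (\<And>j. j \<in> {1..n} \<Longrightarrow> 0 < norm (z j) \<and> norm (z j) < r) \<Longrightarrow>
      ((\<lambda>k. d k * (\<Prod>j=1..n. z j powi k j)) has_sum 0) ({1..n} \<rightarrow>\<^sub>E UNIV)"
  shows "d (\<lambda>j\<in>{1..n}. 0) = 0"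
proof (rule ccontr)
  define E where "E = ({1..n} \<rightarrow>\<^sub>E (UNIV :: int set))"
  define k\<^sub>0 where "k\<^sub>0 = (\<lambda>j\<in>{1..n}. 0 :: int)"
  define \<rho> where "\<rho> = complex_of_real (r / 2)"
  define g where "g = (\<lambda>k. d k * (\<Prod>j=1..n. \<rho> powi k j))"
  assume "d (\<lambda>j\<in>{1..n}. 0) \<noteq> 0"
  have \<rho>: "0 < norm \<rho>" "norm \<rho> < r" "\<rho> \<noteq> 0"
    using \<open>r > 0\<close> by (auto simp: \<rho>_def)
  have zero_E: "k\<^sub>0 \<in> E" by (simp add: k\<^sub>0_def E_def)
  have g0: "g k\<^sub>0 = d k\<^sub>0" by (simp add: g_def k\<^sub>0_def)
  have "(g has_sum 0) E"
    using zero[of "\<lambda>_. \<rho>"] \<rho> by (simp add: g_def E_def)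
  then have "Infinite_Sum.abs_summable_on g E"
    using summable_on_iff_abs_summable_on_complex summable_on_def by blast
  then obtain T where T: "((\<lambda>k. norm (g k)) has_sum T) E"
    by (auto simp: summable_on_def)
  define \<epsilon> where "\<epsilon> = norm (d k\<^sub>0)"
  have "\<epsilon> > 0"
    using \<open>d _ \<noteq> 0\<close> by (simp add: \<epsilon>_def k\<^sub>0_def)
  \<comment> \<open>\<open>\<epsilon>\<close> is the size of the supposedly nonzero constant
    coefficient: outside a large enough finite set the absolute terms are too small to cancel
    it.\<close>
  with T obtain X where X: "finite X" "X \<subseteq> E"
    "\<And>Y. finite Y \<Longrightarrow> X \<subseteq> Y \<Longrightarrow> Y \<subseteq> E \<Longrightarrow> dist (\<Sum>k\<in>Y. norm (g k)) T < \<epsilon>"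
    unfolding has_sum_def tendsto_iff eventually_finite_subsets_at_top by metis
  define S where "S = insert k\<^sub>0 X"
  have S: "finite S" "S \<subseteq> E" "k\<^sub>0 \<in> S" and dist_S: "dist (\<Sum>k\<in>S. norm (g k)) T < \<epsilon>"
    using X(1,2) X(3)[of S] zero_E by (auto simp: S_def)
  have tail: "((\<lambda>k. norm (g k)) has_sum (T - (\<Sum>k\<in>S. norm (g k)))) (E - S)"
    by (intro has_sum_Diff T has_sum_finite S)
  \<comment> \<open>Larger than every exponent occurring in \<open>S\<close>, so \<open>N\<close>
    divides such an exponent only if it is 0.\<close>
  define N where "N = Suc (\<Sum>k\<in>S. \<Sum>j=1..n. nat \<bar>k j\<bar>)"
  have N: "nat \<bar>k j\<bar> < N" if "k \<in> S" "j \<in> {1..n}" for k j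
  proof -
    have "nat \<bar>k j\<bar> \<le> (\<Sum>j=1..n. nat \<bar>k j\<bar>)"
      by (rule member_le_sum) (use that in auto)
    also have "\<dots> \<le> (\<Sum>k\<in>S. \<Sum>j=1..n. nat \<bar>k j\<bar>)"
      using that S by (intro member_le_sum) auto
    finally show ?thesis by (simp add: N_def)
  qed
  have "N > 0" by (simp add: N_def)
  define \<zeta> where "\<zeta> = cis (2 * pi / real N)"
  define W where "W = ({1..n} \<rightarrow>\<^sub>E {..<N})"
  define u where "u = (\<lambda>k. if \<forall>j\<in>{1..n}. int N dvd k j then g k else 0)"
  have average: "(\<Sum>w\<in>W. d k * (\<Prod>j=1..n. (\<rho> * \<zeta> ^ w j) powi k j)) = of_nat N ^ n * u k" for k
  proof -
    have "(\<Sum>w\<in>W. d k * (\<Prod>j=1..n. (\<rho> * \<zeta> ^ w j) powi k j)) =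
        d k * (\<Prod>j=1..n. \<Sum>t<N. (\<rho> * \<zeta> ^ t) powi k j)"
      unfolding W_def by (subst prod_sum_PiE) (auto simp: sum_distrib_left)
    also have "(\<Prod>j=1..n. \<Sum>t<N. (\<rho> * \<zeta> ^ t) powi k j) =
        (\<Prod>j=1..n. \<rho> powi k j * (if int N dvd k j then of_nat N else 0))"
      by (intro prod.cong refl)
         (simp add: power_int_mult_distrib \<zeta>_def sum_roots_of_unity_powi \<open>N > 0\<close> flip: sum_distrib_left)
    also have "\<dots> = (\<Prod>j=1..n. \<rho> powi k j) * (\<Prod>j=1..n. if int N dvd k j then of_nat N else 0)"
      by (rule prod.distrib)
    also have "(\<Prod>j=1..n. if int N dvd k j then of_nat N else (0::complex)) =
        (if \<forall>j\<in>{1..n}. int N dvd k j then of_nat N ^ n else 0)"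
      by (auto simp: prod_zero_iff)
    finally show ?thesis by (simp add: u_def g_def)
  qed
  have "((\<lambda>k. \<Sum>w\<in>W. d k * (\<Prod>j=1..n. (\<rho> * \<zeta> ^ w j) powi k j)) has_sum (\<Sum>w\<in>W. 0)) E"
    unfolding E_def
    by (intro has_sum_sum zero) (use \<rho> in \<open>simp add: \<zeta>_def norm_mult norm_power\<close>)
  then have "((\<lambda>k. of_nat N ^ n * u k) has_sum 0) E"
    by (simp only: average sum.neutral_const)
  then have "(u has_sum 0) E"
    by (subst (asm) has_sum_cmult_right_iff) (use \<open>N > 0\<close> in auto)
  then have u_tail: "(u has_sum (0 - (\<Sum>k\<in>S. u k))) (E - S)"
    by (intro has_sum_Diff has_sum_finite S)
  have "u k = 0" if k: "k \<in> S" "k \<noteq> k\<^sub>0" for k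
  proof -
    have "\<exists>j\<in>{1..n}. k j \<noteq> 0"
    proof (rule ccontr)
      assume "\<not> ?thesis"
      then have "k = k\<^sub>0"
        using k S(2) by (intro PiE_ext[of k "{1..n}" "\<lambda>_. UNIV" k\<^sub>0]) (auto simp: E_def k\<^sub>0_def)
      with k show False by simp
    qed
    then obtain j where j: "j \<in> {1..n}" "k j \<noteq> 0" by blast
    have "\<not> int N dvd k j"
      using N[OF k(1) j(1)] j(2) dvd_imp_le_int[of "k j" "int N"] by auto
    with j(1) show ?thesis by (auto simp: u_def)
  qed
  then have "(\<Sum>k\<in>S. u k) = (\<Sum>k\<in>{k\<^sub>0}. u k)"
    using S by (intro sum.mono_neutral_right) auto
  also have "\<dots> = d k\<^sub>0"
    by (simp add: u_def g0) (simp add: k\<^sub>0_def)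
  finally have "(u has_sum (- d k\<^sub>0)) (E - S)"
    using u_tail by simp
  \<comment> \<open>The tail of \<open>u\<close> must cancel the constant coefficient, yet it is
    dominated by the tail of \<open>norm (g k)\<close>, which is smaller than
    \<open>\<epsilon>\<close>.\<close>
  then have "norm (- d k\<^sub>0) \<le> T - (\<Sum>k\<in>S. norm (g k))"
    by (rule norm_infsum_le[OF _ tail]) (auto simp: u_def)
  with dist_S show False
    by (simp add: \<epsilon>_def dist_real_def)
qed

text \<open>Two expansions of one function differ by an expansion of 0 on the smaller polydisc, so
  the description in \<open>constant_term\<close> has a unique solution.\<close>

lemma constant_term_eqI:
  assumes b: "has_multi_laurent_expansion n F b"
  shows "constant_term n F = b (\<lambda>j\<in>{1..n}. 0)"
  unfolding constant_term_def
proof (rule the_equality)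
  fix t assume "\<exists>b. has_multi_laurent_expansion n F b \<and> t = b (\<lambda>j\<in>{1..n}. 0)"
  then obtain b' where b': "has_multi_laurent_expansion n F b'" and t: "t = b' (\<lambda>j\<in>{1..n}. 0)"
    by blast
  obtain r r' where r: "r > 0" "\<And>z. \<forall>j\<in>{1..n}. 0 < norm (z j) \<and> norm (z j) < r \<Longrightarrow>
        ((\<lambda>k. b k * (\<Prod>j=1..n. z j powi k j)) has_sum F z) ({1..n} \<rightarrow>\<^sub>E UNIV)"
    and r': "r' > 0" "\<And>z. \<forall>j\<in>{1..n}. 0 < norm (z j) \<and> norm (z j) < r' \<Longrightarrow>
        ((\<lambda>k. b' k * (\<Prod>j=1..n. z j powi k j)) has_sum F z) ({1..n} \<rightarrow>\<^sub>E UNIV)"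
    using b b' unfolding has_multi_laurent_expansion_def by blast
  have "b' (\<lambda>j\<in>{1..n}. 0) - b (\<lambda>j\<in>{1..n}. 0) = 0"
  proof (rule multi_laurent_zero_imp_constant_coeff_zero[of "min r r'" n "\<lambda>k. b' k - b k"])
    fix z :: "nat \<Rightarrow> complex"
    assume "\<And>j. j \<in> {1..n} \<Longrightarrow> 0 < norm (z j) \<and> norm (z j) < min r r'"
    then show "((\<lambda>k. (b' k - b k) * (\<Prod>j=1..n. z j powi k j)) has_sum 0) ({1..n} \<rightarrow>\<^sub>E UNIV)"
      using has_sum_add[OF r'(2)[of z] has_sum_uminusI[OF r(2)[of z]]]
      by (simp add: left_diff_distrib)
  qed (use r(1) r'(1) in simp)
  with t show "t = b (\<lambda>j\<in>{1..n}. 0)" by simp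
qed (use b in blast)

section \<open>From one-variable power series to convergent Laurent series\<close>

lemma has_sum_laurent_shift:
  fixes p :: "complex fps"
  assumes "((\<lambda>k. fps_nth p k * z ^ k) has_sum s) UNIV" and "z \<noteq> 0"
  shows "((\<lambda>k. fps_coeff_int p (k - e) * z powi k) has_sum (s * z powi e)) UNIV"
proof -
  have "((\<lambda>k. fps_nth p k * z ^ k * z powi e) has_sum (s * z powi e)) UNIV"
    using assms(1) by (rule has_sum_cmult_left)
  also have "?this \<longleftrightarrow> ((\<lambda>k. fps_coeff_int p (k - e) * z powi k) has_sum (s * z powi e)) {e..}"
    by (rule has_sum_reindex_bij_witness[of _ "\<lambda>k. nat (k - e)" "\<lambda>k. int k + e"])
       (auto simp: power_int_add assms(2))
  \<comment> \<open>The coefficients below \<open>e\<close> vanish, so the sum may run over all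
    integers, as the definition of a multiple expansion demands.\<close>
  also have "\<dots> \<longleftrightarrow> ((\<lambda>k. fps_coeff_int p (k - e) * z powi k) has_sum (s * z powi e)) UNIV"
    by (rule has_sum_cong_neutral) auto
  finally show ?thesis .
qed

text \<open>Near 0 the argument lies inside the disc of convergence, where the power series
  converges absolutely and hence unconditionally.\<close>

lemma has_fps_expansion_imp_has_sum:
  fixes f :: "complex \<Rightarrow> complex"
  assumes "f has_fps_expansion F"
  obtains r where "r > 0" and
    "\<And>z. norm z < r \<Longrightarrow> ((\<lambda>k. fps_nth F k * z ^ k) has_sum f z) UNIV"
proof -
  have "eventually (\<lambda>z. z \<in> eball 0 (fps_conv_radius F) \<and> eval_fps F z = f z) (nhds 0)"
    using assms by (intro eventually_conj eventually_nhds_in_open)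
      (auto simp: has_fps_expansion_def zero_ereal_def)
  then obtain r where r: "r > 0"
    "\<And>z. norm z < r \<Longrightarrow> z \<in> eball 0 (fps_conv_radius F) \<and> eval_fps F z = f z"
    by (auto simp: eventually_nhds_metric)
  have "((\<lambda>k. fps_nth F k * z ^ k) has_sum f z) UNIV" if z: "norm z < r" for z
  proof (rule norm_summable_imp_has_sum)
    have *: "ereal (norm z) < fps_conv_radius F"
      using r(2)[OF z] by (simp add: in_eball_iff)
    then show "summable (\<lambda>k. norm (fps_nth F k * z ^ k))"
      unfolding fps_conv_radius_def by (rule abs_summable_in_conv_radius)
    show "(\<lambda>k. fps_nth F k * z ^ k) sums f z"
      using summable_sums[OF summable_fps[OF *]] r(2)[OF z] by (simp add: eval_fps_def)
  qed
  with r(1) show ?thesis by (rule that)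
qed

lemma has_fps_expansion_binomial_scaled:
  fixes s \<alpha> :: complex
  shows "(\<lambda>z. (1 + s * z) powr \<alpha>) has_fps_expansion fps_binomial_scaled s \<alpha>"
proof (rule has_fps_expansionI)
  have "open {u. norm (s * u) < 1}"
    by (intro open_Collect_less continuous_intros)
  then have "eventually (\<lambda>u. u \<in> {u. norm (s * u) < 1}) (nhds 0)"
    by (rule eventually_nhds_in_open) simp
  then show "eventually (\<lambda>u. (\<lambda>k. fps_nth (fps_binomial_scaled s \<alpha>) k * u ^ k) sums
      (1 + s * u) powr \<alpha>) (nhds 0)"
  proof eventually_elim
    case (elim u)
    then show ?case
      using gen_binomial_complex[of "s * u" \<alpha>]
      by (simp add: fps_binomial_scaled_nth power_mult_distrib mult_ac)
  qed
qed

lemma fps_nth_binomial_scaled_of_real: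
  "fps_nth (fps_binomial_scaled (of_real s) (of_real \<alpha>) :: 'a::{real_field,field_char_0} fps) k =
    of_real (fps_nth (fps_binomial_scaled s \<alpha>) k)"
  by (simp add: fps_binomial_scaled_nth gbinomial_prod_rev)

subsection \<open>The constant term as a Toeplitz determinant\<close>

text \<open>Each index lies in exactly \<open>n - 1\<close> of the pairs.\<close>

lemma prod_pairs_mult:
  fixes w :: "nat \<Rightarrow> 'a::comm_monoid_mult"
  shows "(\<Prod>j<n. \<Prod>i<j. w i * w j) = (\<Prod>j<n. w j) ^ (n - 1)"
proof (induction n)
  case (Suc n)
  have "(\<Prod>j<Suc n. \<Prod>i<j. w i * w j) = (\<Prod>j<n. w j) ^ (n - 1) * (\<Prod>i<n. w i * w n)"
    by (simp only: prod.lessThan_Suc Suc.IH)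
  also have "\<dots> = (\<Prod>j<n. w j) ^ (n - 1) * (\<Prod>i<n. w i) * w n ^ n"
    by (simp add: prod.distrib mult.assoc)
  also have "\<dots> = (\<Prod>j<Suc n. w j) ^ (Suc n - 1)"
    by (cases n) (simp_all add: power_mult_distrib mult_ac)
  finally show ?case .
qed simp

text \<open>Rests on (u - v)^2 = - u v (v - u) (1/v - 1/u): the last two factors build Vandermonde
  products in the variables and in their inverses.\<close>

lemma prod_sq_differences:
  fixes w :: "nat \<Rightarrow> 'a::field"
  assumes "\<And>i. i < n \<Longrightarrow> w i \<noteq> 0"
  shows "(\<Prod>j<n. \<Prod>i<j. (w i - w j)\<^sup>2) = (- 1) ^ (n choose 2) * (\<Prod>j<n. w j) ^ (n - 1) *
    (Determinant.det (Matrix.mat n n (\<lambda>(i,j). w i ^ j)) *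
     Determinant.det (Matrix.mat n n (\<lambda>(i,j). inverse (w i) ^ j)))"
proof -
  have "(\<Prod>j<n. \<Prod>i<j. (w i - w j)\<^sup>2) = (\<Prod>j<n. \<Prod>i<j. (- 1) * ((w i * w j) *
      ((w j - w i) * (inverse (w j) - inverse (w i)))))"
  proof (intro prod.cong refl)
    fix i j assume "j \<in> {..<n}" "i \<in> {..<j}"
    then have "w i \<noteq> 0" "w j \<noteq> 0" using assms by auto
    then show "(w i - w j)\<^sup>2 = (- 1) * ((w i * w j) *
        ((w j - w i) * (inverse (w j) - inverse (w i))))"
      by (simp add: field_simps power2_eq_square)
  qed
  also have "\<dots> = (\<Prod>j<n. \<Prod>i<j. - 1) * ((\<Prod>j<n. \<Prod>i<j. w i * w j) *
      ((\<Prod>j<n. \<Prod>i<j. w j - w i) * (\<Prod>j<n. \<Prod>i<j. inverse (w j) - inverse (w i))))"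
    by (simp only: prod.distrib)
  also have "(\<Prod>j<n. \<Prod>i<j. - 1 :: 'a) = (- 1) ^ (n choose 2)"
    by (simp add: prod_power_lessThan)
  finally show ?thesis
    by (simp only: det_vandermonde prod_pairs_mult mult.assoc)
qed

text \<open>Writes the product as a signed sum of Laurent monomials, in each of which the variables
  separate.\<close>

lemma det_vandermonde_mult_inverse:
  fixes w :: "nat \<Rightarrow> 'a::field"
  assumes "\<And>i. i < n \<Longrightarrow> w i \<noteq> 0"
  shows "Determinant.det (Matrix.mat n n (\<lambda>(i,j). w i ^ j)) *
      Determinant.det (Matrix.mat n n (\<lambda>(i,j). inverse (w i) ^ j)) =
    (\<Sum>\<sigma> | \<sigma> permutes {0..<n}. \<Sum>\<tau> | \<tau> permutes {0..<n}. signof \<sigma> * signof \<tau> *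
      (\<Prod>i<n. w i powi (int (\<sigma> i) - int (\<tau> i))))"
proof -
  have det: "Determinant.det (Matrix.mat n n (\<lambda>(i,j). v i ^ j)) =
      (\<Sum>\<sigma> | \<sigma> permutes {0..<n}. signof \<sigma> * (\<Prod>i<n. v i ^ \<sigma> i))" for v :: "nat \<Rightarrow> 'a"
    by (subst det_def'[of _ n])
       (auto simp: lessThan_atLeast0 permutes_in_image intro!: sum.cong prod.cong)
  have "(\<Prod>i<n. w i ^ \<sigma> i) * (\<Prod>i<n. inverse (w i) ^ \<tau> i) =
      (\<Prod>i<n. w i powi (int (\<sigma> i) - int (\<tau> i)))" for \<sigma> \<tau>
    using assms
    by (auto simp: power_int_diff field_simps simp flip: prod.distrib intro!: prod.cong)
  then show ?thesis
    unfolding det sum_product by (intro sum.cong refl) (simp add: mult_ac)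
qed

text \<open>The power \<open>n - 1\<close> from the squared differences cancels against the
  denominator and leaves z_j^(-m). Every pair of permutations then gives a product of one-variable
  functions, whose constant coefficient is a product of Toeplitz entries.\<close>

lemma constant_term_vandermonde_squared:
  assumes "f has_fps_expansion p"
  shows "constant_term n (\<lambda>z. (\<Prod>j=1..n. f (z j) / z j ^ (m + n - 1)) *
      (\<Prod>j=1..n. \<Prod>i\<in>{1..<j}. (z i - z j)\<^sup>2)) =
    (- 1) ^ (n choose 2) * (fact n *
      Determinant.det (Matrix.mat n n (\<lambda>(i,j). fps_coeff_int p (int m + int j - int i))))"
    (is "constant_term n ?F = _")
proof -
  obtain r where r: "r > 0"
    "\<And>z. norm z < r \<Longrightarrow> ((\<lambda>k. fps_nth p k * z ^ k) has_sum f z) UNIV"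
    using has_fps_expansion_imp_has_sum[OF assms] by blast
  \<comment> \<open>The exponent of \<open>z j\<close> beside \<open>f (z j)\<close>; the shift
    \<open>j - 1\<close> is needed because the permutations act on \<open>{0..<n}\<close>.\<close>
  define e where "e = (\<lambda>\<sigma> \<tau> j. int (\<sigma> (j - 1 :: nat)) - int (\<tau> (j - 1)) - int m)"
  define b where "b = (\<lambda>k. (- 1) ^ (n choose 2) *
    (\<Sum>\<sigma> | \<sigma> permutes {0..<n}. \<Sum>\<tau> | \<tau> permutes {0..<n}.
      signof \<sigma> * signof \<tau> * (\<Prod>j=1..n. fps_coeff_int p (k j - e \<sigma> \<tau> j))))"
  have "((\<lambda>k. b k * (\<Prod>j=1..n. z j powi k j)) has_sum ?F z) ({1..n} \<rightarrow>\<^sub>E UNIV)"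
    if z: "\<And>j. j \<in> {1..n} \<Longrightarrow> 0 < norm (z j) \<and> norm (z j) < r" for z
  proof -
    have nz: "z j \<noteq> 0" if "j \<in> {1..n}" for j
      using z[OF that] by auto
    have "((\<lambda>k. \<Prod>j=1..n. fps_coeff_int p (k j - e \<sigma> \<tau> j) * z j powi k j) has_sum
        (\<Prod>j=1..n. f (z j) * z j powi e \<sigma> \<tau> j)) ({1..n} \<rightarrow>\<^sub>E UNIV)" for \<sigma> \<tau>
      by (intro has_sum_prod_PiE has_sum_laurent_shift r(2) nz) (use z in auto)
    then have "((\<lambda>k. (- 1) ^ (n choose 2) *
        (\<Sum>\<sigma> | \<sigma> permutes {0..<n}. \<Sum>\<tau> | \<tau> permutes {0..<n}. signof \<sigma> * signof \<tau> *
          (\<Prod>j=1..n. fps_coeff_int p (k j - e \<sigma> \<tau> j) * z j powi k j))) has_sum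
        (- 1) ^ (n choose 2) * (\<Sum>\<sigma> | \<sigma> permutes {0..<n}. \<Sum>\<tau> | \<tau> permutes {0..<n}.
          signof \<sigma> * signof \<tau> * (\<Prod>j=1..n. f (z j) * z j powi e \<sigma> \<tau> j)))
        ({1..n} \<rightarrow>\<^sub>E UNIV)"
      by (intro has_sum_cmult_right has_sum_sum)
    also have "(\<lambda>k. (- 1) ^ (n choose 2) *
        (\<Sum>\<sigma> | \<sigma> permutes {0..<n}. \<Sum>\<tau> | \<tau> permutes {0..<n}. signof \<sigma> * signof \<tau> *
          (\<Prod>j=1..n. fps_coeff_int p (k j - e \<sigma> \<tau> j) * z j powi k j))) =
        (\<lambda>k. b k * (\<Prod>j=1..n. z j powi k j))"
      by (simp add: b_def prod.distrib sum_distrib_left sum_distrib_right mult_ac)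
    also have "(- 1) ^ (n choose 2) * (\<Sum>\<sigma> | \<sigma> permutes {0..<n}. \<Sum>\<tau> | \<tau> permutes {0..<n}.
          signof \<sigma> * signof \<tau> * (\<Prod>j=1..n. f (z j) * z j powi e \<sigma> \<tau> j)) = ?F z"
    proof -
      define w where "w = (\<lambda>i. z (Suc i))"
      have w: "w i \<noteq> 0" if "i < n" for i
        using nz[of "Suc i"] that by (simp add: w_def)
      have factor: "((\<Prod>j<n. f (w j)) / (\<Prod>j<n. w j) ^ m) *
          (\<Prod>i<n. w i powi (int (\<sigma> i) - int (\<tau> i))) =
          (\<Prod>j=1..n. f (z j) * z j powi e \<sigma> \<tau> j)" for \<sigma> \<tau>
      proof -
        have "(\<Prod>j=1..n. f (z j) * z j powi e \<sigma> \<tau> j) =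
            (\<Prod>j<n. f (w j) / w j ^ m * w j powi (int (\<sigma> j) - int (\<tau> j)))"
          unfolding One_nat_def prod.atLeast1_atMost_eq e_def
          by (intro prod.cong refl) (use w in \<open>auto simp: w_def power_int_diff\<close>)
        then show ?thesis
          by (simp add: prod.distrib prod_dividef prod_power_distrib)
      qed
      have "(\<Prod>j=1..n. \<Prod>i\<in>{1..<j}. (z i - z j)\<^sup>2) =
          (\<Prod>j<n. \<Prod>i<j. (w i - w j)\<^sup>2)"
        by (simp add: prod.atLeast1_atMost_eq w_def prod.shift_bounds_Suc_ivl
              lessThan_atLeast0 del: prod.op_ivl_Suc)
      also have "\<dots> = (- 1) ^ (n choose 2) * (\<Prod>j<n. w j) ^ (n - 1) *
          (\<Sum>\<sigma> | \<sigma> permutes {0..<n}. \<Sum>\<tau> | \<tau> permutes {0..<n}. signof \<sigma> * signof \<tau> *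
            (\<Prod>i<n. w i powi (int (\<sigma> i) - int (\<tau> i))))"
        by (simp only: prod_sq_differences[OF w] det_vandermonde_mult_inverse[OF w])
      finally have differences: "(\<Prod>j=1..n. \<Prod>i\<in>{1..<j}. (z i - z j)\<^sup>2) = \<dots>" .
      have "(\<Prod>j=1..n. f (z j) / z j ^ (m + n - 1)) =
          (\<Prod>j<n. f (w j)) / ((\<Prod>j<n. w j) ^ m * (\<Prod>j<n. w j) ^ (n - 1))"
      proof -
        \<comment> \<open>Any factor has \<open>j < n\<close>, hence \<open>n \<ge> 1\<close>, and
          the exponent splits as \<open>m + (n - 1)\<close> without truncation.\<close>
        have "(\<Prod>j=1..n. f (z j) / z j ^ (m + n - 1)) = (\<Prod>j<n. f (w j) / (w j ^ m * w j ^ (n - 1)))"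
          unfolding One_nat_def prod.atLeast1_atMost_eq
          by (intro prod.cong refl) (simp add: w_def flip: power_add)
        then show ?thesis
          by (simp add: prod_dividef prod.distrib prod_power_distrib)
      qed
      moreover have "(\<Prod>j<n. w j) \<noteq> 0"
        using w by simp
      then have "A / ((\<Prod>j<n. w j) ^ m * (\<Prod>j<n. w j) ^ (n - 1)) *
          (s * (\<Prod>j<n. w j) ^ (n - 1) * B) = s * (A / (\<Prod>j<n. w j) ^ m) * B" for s A B
        by simp
      ultimately have "?F z = (- 1) ^ (n choose 2) * ((\<Prod>j<n. f (w j)) / (\<Prod>j<n. w j) ^ m) *
          (\<Sum>\<sigma> | \<sigma> permutes {0..<n}. \<Sum>\<tau> | \<tau> permutes {0..<n}. signof \<sigma> * signof \<tau> *
            (\<Prod>i<n. w i powi (int (\<sigma> i) - int (\<tau> i))))"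
        by (simp only: differences)
      also have "\<dots> = (- 1) ^ (n choose 2) * (\<Sum>\<sigma> | \<sigma> permutes {0..<n}. \<Sum>\<tau> | \<tau> permutes {0..<n}.
          signof \<sigma> * signof \<tau> * (((\<Prod>j<n. f (w j)) / (\<Prod>j<n. w j) ^ m) *
            (\<Prod>i<n. w i powi (int (\<sigma> i) - int (\<tau> i)))))"
        by (simp add: sum_distrib_left mult_ac)
      finally show ?thesis
        by (simp only: factor)
    qed
    finally show ?thesis .
  qed
  then have "has_multi_laurent_expansion n ?F b"
    using r(1) unfolding has_multi_laurent_expansion_def by blast
  then have "constant_term n ?F = b (\<lambda>j\<in>{1..n}. 0)"
    by (rule constant_term_eqI)
  also have "\<dots> = (- 1) ^ (n choose 2) *
      (\<Sum>\<sigma> | \<sigma> permutes {0..<n}. \<Sum>\<tau> | \<tau> permutes {0..<n}. signof \<sigma> * signof \<tau> *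
        (\<Prod>j<n. fps_coeff_int p (int m + int (\<tau> j) - int (\<sigma> j))))"
    unfolding b_def One_nat_def prod.atLeast1_atMost_eq by (simp add: e_def algebra_simps)
  also have "\<dots> = (- 1) ^ (n choose 2) * (fact n *
      Determinant.det (Matrix.mat n n (\<lambda>(i,j). fps_coeff_int p (int m + int j - int i))))"
    by (subst sum_permutation_pairs_det) simp
  finally show ?thesis .
qed

section \<open>Passage from complex to real coefficients and collection of the signs\<close>

theorem mainTheorem12:
  fixes a x c :: real and n m :: nat
  assumes "a \<noteq> 0" and "a \<noteq> 1" and "n \<ge> 1" and "m \<ge> 1"
  shows "constant_term n (meixner_integrand a c x n m) =
    complex_of_real ((- 1) ^ ((m choose 2) + (n choose 2) + n * m) * fact n * a ^ (m choose 2) *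
      Determinant.det (meixner_matrix a c x n m))"
proof -
  define s y where "s = - (1 / a)" and "y = x + c + real n - 1"
  define f :: "complex \<Rightarrow> complex"
    where "f = (\<lambda>z. (1 + of_real s * z) powr of_real x * (1 + of_real (- 1) * z) powr of_real (- y))"
  define P where "P = fps_binomial_scaled s x * fps_binomial_scaled (- 1) (- y)"
  define Q where "Q = fps_binomial_scaled s (- x) * fps_binomial_scaled (- 1) y"
  \<comment> \<open>The complex copy of \<open>P\<close>: the integrand is complex, while the
    Meixner determinant and the Toeplitz identity are used over the reals.\<close>
  define p :: "complex fps" where "p = fps_binomial_scaled (of_real s) (of_real x) *
    fps_binomial_scaled (of_real (- 1)) (of_real (- y))"
  let ?P = "Matrix.mat n n (\<lambda>(i,j). fps_coeff_int P (int m + int j - int i))"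
  have p_nth: "fps_nth p k = of_real (fps_nth P k)" for k
    unfolding p_def P_def fps_mult_nth fps_nth_binomial_scaled_of_real by simp
  have "P * Q = (fps_binomial_scaled s x * fps_binomial_scaled s (- x)) *
      (fps_binomial_scaled (- 1) (- y) * fps_binomial_scaled (- 1) y)"
    by (simp add: P_def Q_def mult_ac)
  then have PQ: "P * Q = 1"
    by (simp add: fps_binomial_scaled_0 flip: fps_binomial_scaled_add)
  have P0: "fps_nth P 0 = 1"
    by (simp add: P_def fps_mult_nth fps_binomial_scaled_nth)
  have "(1 - u / of_real a) powr of_real x / ((1 - u) powr of_real y * v) = f u / v"
    for u v :: complex
    by (simp add: f_def s_def powr_minus_divide)
  then have "meixner_integrand a c x n m = (\<lambda>z. (\<Prod>j=1..n. f (z j) / z j ^ (m + n - 1)) *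
      (\<Prod>j=1..n. \<Prod>i\<in>{1..<j}. (z i - z j)\<^sup>2))"
    by (simp only: meixner_integrand_def y_def fun_eq_iff simp_thms)
  moreover have "f has_fps_expansion p"
    unfolding f_def p_def by (intro has_fps_expansion_mult has_fps_expansion_binomial_scaled)
  ultimately have "constant_term n (meixner_integrand a c x n m) = (- 1) ^ (n choose 2) *
      (fact n * Determinant.det (Matrix.mat n n (\<lambda>(i,j). fps_coeff_int p (int m + int j - int i))))"
    by (simp only: constant_term_vandermonde_squared)
  also have "Matrix.mat n n (\<lambda>(i,j). fps_coeff_int p (int m + int j - int i)) = map_mat of_real ?P"
    by (intro eq_matI) (auto simp: fps_coeff_int_def p_nth)
  also have "Determinant.det \<dots> = of_real (Determinant.det ?P)"
    by (rule of_real_hom.hom_det)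
  finally have CT: "constant_term n (meixner_integrand a c x n m) =
      of_real ((- 1) ^ (n choose 2) * fact n * Determinant.det ?P)"
    by simp
  have "a ^ (m choose 2) * Determinant.det (meixner_matrix a c x n m) =
      (- 1) ^ (m choose 2) * ((- 1) ^ (n * m) * Determinant.det ?P)"
    unfolding det_toeplitz_inverse[OF PQ P0, symmetric]
    using det_meixner_matrix[OF \<open>a \<noteq> 0\<close>] by (simp add: Q_def s_def y_def)
  moreover have "(- 1) ^ ((m choose 2) + (n choose 2) + n * m) * fact n * a ^ (m choose 2) *
      Determinant.det (meixner_matrix a c x n m) =
      (- 1) ^ (m choose 2) * (- 1) ^ (n choose 2) * (- 1) ^ (n * m) * fact n *
      (a ^ (m choose 2) * Determinant.det (meixner_matrix a c x n m))"
    by (simp only: power_add mult_ac)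
  \<comment> \<open>The signs with exponents \<open>m choose 2\<close> and \<open>n * m\<close> each
    occur twice and cancel; only the Vandermonde sign remains.\<close>
  ultimately have "(- 1) ^ ((m choose 2) + (n choose 2) + n * m) * fact n * a ^ (m choose 2) *
      Determinant.det (meixner_matrix a c x n m) =
      (- 1) ^ (n choose 2) * fact n * Determinant.det ?P"
    by (simp add: mult_ac)
  with CT show ?thesis by (simp only:)
qed

end
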